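(* If $v \ge 6$, then the localization number of the incidence graph of any Steiner system $S(3,4,v)$ is at most $v - 3$.
   Context: A Steiner system $S(t,k,v)$ with $2 \le t < k < v$ is a set $X$ of $v$ points with a collection of $k$-element subsets (blocks) such that every $t$-subset of $X$ lies in exactly one block; $S(3,4,v)$ is a Steiner quadruple system. Its incidence graph is the bipartite graph on points and blocks with $x \sim B$ iff $x \in B$. Localization game on a connected graph $G$ with $k$ cops: the robber chooses a starting vertex, invisible to the cops. Each round the cops choose any $k$ vertices (no adjacency restriction) and each learns its distance to the robber; the cops win if after finitely many rounds they determine the robber's vertex uniquely; otherwise the robber moves to a neighbour or stays. The robber knows the cops' strategy. The localization number $\zeta(G)$ is the least $k$ for which $k$ cops can guarantee capture. *)

theory Defs
  imports "Graph_Theory.Graph_Theory" "HOL-Library.Extended_Nat"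
begin

definition steiner_system ::
    "nat \<Rightarrow> nat \<Rightarrow> nat \<Rightarrow> 'a set \<Rightarrow> 'a set set \<Rightarrow> bool" where
  "steiner_system t k v X \<B> \<longleftrightarrow>
     2 \<le> t \<and> t < k \<and> k < v \<and>
     finite X \<and> card X = v \<and>
     (\<forall>b\<in>\<B>. b \<subseteq> X \<and> card b = k) \<and>
     (\<forall>T. T \<subseteq> X \<and> card T = t \<longrightarrow> (\<exists>!b. b \<in> \<B> \<and> T \<subseteq> b))"

text \<open>An undirected graph is represented as a digraph having both arcs for each edge.\<close>

definition incidence_graph :: "'a set \<Rightarrow> 'a set set \<Rightarrow> ('a + 'a set) pair_pre_digraph" where
  "incidence_graph X \<B> =
     \<lparr> pverts = Inl ` X \<union> Inr ` \<B>,
       parcs = {(Inl x, Inr b) | x b. x \<in> X \<and> b \<in> \<B> \<and> x \<in> b} \<union>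
               {(Inr b, Inl x) | x b. x \<in> X \<and> b \<in> \<B> \<and> x \<in> b} \<rparr>"

definition graph_dist :: "'v pair_pre_digraph \<Rightarrow> 'v \<Rightarrow> 'v \<Rightarrow> enat" where
  "graph_dist G u w = (INF p \<in> {p. pre_digraph.awalk (with_proj G) u p w}. enat (length p))"

text \<open>
  A play of the robber is the sequence of his positions, \<open>r n\<close> being the vertex he occupies
  when the cops make their probe number \<open>n\<close> (counting from 0).
\<close>

definition robber_play :: "'v pair_pre_digraph \<Rightarrow> (nat \<Rightarrow> 'v) \<Rightarrow> bool" where
  "robber_play G r \<longleftrightarrow>
     r 0 \<in> pverts G \<and> (\<forall>n. r (Suc n) = r n \<or> (r n, r (Suc n)) \<in> parcs G)"

text \<open>
  A strategy of the cops maps the answers of all earlier rounds to the list of the next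
  positions of the cops; an answer lists the distances learned by the individual cops.
\<close>

type_synonym 'v cop_strategy = "enat list list \<Rightarrow> 'v list"

definition cop_strategy :: "'v pair_pre_digraph \<Rightarrow> nat \<Rightarrow> 'v cop_strategy \<Rightarrow> bool" where
  "cop_strategy G k \<sigma> \<longleftrightarrow> (\<forall>h. length (\<sigma> h) = k \<and> set (\<sigma> h) \<subseteq> pverts G)"

primrec answers ::
    "'v pair_pre_digraph \<Rightarrow> 'v cop_strategy \<Rightarrow> (nat \<Rightarrow> 'v) \<Rightarrow> nat \<Rightarrow> enat list list" where
  "answers G \<sigma> r 0 = []"
| "answers G \<sigma> r (Suc n) =
     answers G \<sigma> r n @ [map (\<lambda>c. graph_dist G c (r n)) (\<sigma> (answers G \<sigma> r n))]"

text \<open>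
  The robber is located by probe \<open>n\<close> if every play that would have produced the same answers
  up to and including this probe has him at the same vertex.
\<close>

definition located ::
    "'v pair_pre_digraph \<Rightarrow> 'v cop_strategy \<Rightarrow> (nat \<Rightarrow> 'v) \<Rightarrow> nat \<Rightarrow> bool" where
  "located G \<sigma> r n \<longleftrightarrow>
     (\<forall>r'. robber_play G r' \<and> answers G \<sigma> r' (Suc n) = answers G \<sigma> r (Suc n)
        \<longrightarrow> r' n = r n)"

definition cops_can_win :: "'v pair_pre_digraph \<Rightarrow> nat \<Rightarrow> bool" where
  "cops_can_win G k \<longleftrightarrow>
     (\<exists>\<sigma>. cop_strategy G k \<sigma> \<and> (\<forall>r. robber_play G r \<longrightarrow> (\<exists>n. located G \<sigma> r n)))"

definition localization_number :: "'v pair_pre_digraph \<Rightarrow> nat" where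
  "localization_number G = (LEAST k. cops_can_win G k)"

lemma graph_dist_eq_0_iff:
  assumes "u \<in> pverts G"
  shows "graph_dist G u w = 0 \<longleftrightarrow> u = w"
proof
  assume "graph_dist G u w = 0"
  then have "graph_dist G u w < enat 1" by (simp add: zero_enat_def)
  then obtain p where "pre_digraph.awalk (with_proj G) u p w" "length p = 0"
    unfolding graph_dist_def INF_less_iff by auto
  then show "u = w"
    by (simp add: pre_digraph.awalk_def pre_digraph.cas.simps)
next
  assume "u = w"
  then have "pre_digraph.awalk (with_proj G) u [] w"
    using assms by (simp add: pre_digraph.awalk_def pre_digraph.cas.simps)
  then have "graph_dist G u w \<le> enat (length ([] :: ('a \<times> 'a) list))"
    unfolding graph_dist_def by (intro INF_lower) simp
  then show "graph_dist G u w = 0" by (simp add: zero_enat_def[symmetric])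
qed

text \<open>Hence the minimum defining the localization number of a finite graph exists.\<close>

lemma cops_can_win_card:
  assumes "finite (pverts G)"
  shows "cops_can_win G (card (pverts G))"
proof -
  obtain vs where vs: "set vs = pverts G" "distinct vs"
    using finite_distinct_list[OF assms] by blast
  have "located G (\<lambda>_. vs) r 0" if r: "robber_play G r" for r
    unfolding located_def
  proof (intro allI impI, elim conjE)
    fix r' assume "answers G (\<lambda>_. vs) r' (Suc 0) = answers G (\<lambda>_. vs) r (Suc 0)"
    then have "graph_dist G (r 0) (r' 0) = graph_dist G (r 0) (r 0)"
      using r vs by (simp add: robber_play_def)
    then show "r' 0 = r 0"
      using r graph_dist_eq_0_iff[of "r 0" G] unfolding robber_play_def by metis
  qed
  moreover have "cop_strategy G (card (pverts G)) (\<lambda>_. vs)"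
    using vs distinct_card[of vs] by (simp add: cop_strategy_def)
  ultimately show ?thesis unfolding cops_can_win_def by blast
qed

end

theory Submission
  imports Defs
begin

text \<open>
  Put the cops on all points outside a triple \<open>T\<close>. A robber on a block \<open>b\<close> reveals \<open>b - T\<close>, and two
  blocks agreeing outside a triple share at least three points, so they coincide. Hence a probe leaves
  only the points of \<open>T\<close> undistinguished. As distinct points are not adjacent, a robber who is on a
  point of \<open>T\<close> now and on a point in the next round did not move; so probing next with a triple that
  meets \<open>T\<close> in a single point locates him.
\<close>

lemma graph_dist_le_length:
  assumes "pre_digraph.awalk (with_proj G) u p w"
  shows "graph_dist G u w \<le> enat (length p)"
  unfolding graph_dist_def using assms by (intro INF_lower) simp

text \<open>A finite infimum of lengths is attained: being below \<open>Suc n\<close>, it has a walk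
  of length at most \<open>n\<close>, and no walk is shorter than the infimum.\<close>

lemma graph_dist_eq_enatE:
  assumes "graph_dist G u w = enat n"
  obtains p where "pre_digraph.awalk (with_proj G) u p w" "length p = n"
proof -
  have "graph_dist G u w < enat (Suc n)" using assms by simp
  then obtain p where p: "pre_digraph.awalk (with_proj G) u p w" "length p < Suc n"
    unfolding graph_dist_def INF_less_iff by auto
  moreover have "n \<le> length p"
    using graph_dist_le_length[OF p(1)] assms by simp
  ultimately show thesis using that by simp
qed

lemma graph_dist_eq_1_iff:
  assumes "u \<in> pverts G" "u \<noteq> w"
  shows "graph_dist G u w = 1 \<longleftrightarrow> (u, w) \<in> parcs G"
proof
  assume "graph_dist G u w = 1"
  then obtain p where p: "pre_digraph.awalk (with_proj G) u p w" "length p = Suc 0"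
    by (metis graph_dist_eq_enatE one_enat_def One_nat_def)
  then obtain e where "p = [e]" by (auto simp: length_Suc_conv)
  then show "(u, w) \<in> parcs G"
    using p by (cases e) (auto simp: pre_digraph.awalk_def pre_digraph.cas.simps)
next
  assume "(u, w) \<in> parcs G"
  then have "pre_digraph.awalk (with_proj G) u [(u, w)] w"
    using assms by (simp add: pre_digraph.awalk_def pre_digraph.cas.simps)
  then have "graph_dist G u w \<le> 1"
    using graph_dist_le_length by (fastforce simp: one_enat_def)
  moreover have "graph_dist G u w \<noteq> 0"
    using assms by (simp add: graph_dist_eq_0_iff)
  ultimately show "graph_dist G u w = 1"
    by (cases "graph_dist G u w") (auto simp: one_enat_def zero_enat_def)
qed

lemma graph_dist_eq_2D:
  assumes "graph_dist G u w = 2"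
  obtains z where "(u, z) \<in> parcs G" "(z, w) \<in> parcs G"
proof -
  obtain p where p: "pre_digraph.awalk (with_proj G) u p w" "length p = Suc (Suc 0)"
    using assms by (metis graph_dist_eq_enatE numeral_eq_enat numeral_2_eq_2)
  then obtain e f where "p = [e, f]" by (auto simp: length_Suc_conv)
  then show thesis
    using p that by (cases e; cases f) (auto simp: pre_digraph.awalk_def pre_digraph.cas.simps)
qed

lemma graph_dist_le_2:
  assumes "u \<in> pverts G" "(u, z) \<in> parcs G" "(z, w) \<in> parcs G"
  shows "graph_dist G u w \<le> 2"
proof -
  have "pre_digraph.awalk (with_proj G) u [(u, z), (z, w)] w"
    using assms by (simp add: pre_digraph.awalk_def pre_digraph.cas.simps)
  from graph_dist_le_length[OF this] show ?thesis
    by (simp add: numeral_eq_enat numeral_2_eq_2)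
qed

lemma pverts_incidence_graph: "pverts (incidence_graph X \<B>) = Inl ` X \<union> Inr ` \<B>"
  by (simp add: incidence_graph_def)

lemma parcs_incidence_graph [simp]:
  "(Inl x, Inl y) \<notin> parcs (incidence_graph X \<B>)"
  "(Inr b, Inr c) \<notin> parcs (incidence_graph X \<B>)"
  "(Inl x, Inr b) \<in> parcs (incidence_graph X \<B>) \<longleftrightarrow> x \<in> X \<and> b \<in> \<B> \<and> x \<in> b"
  "(Inr b, Inl x) \<in> parcs (incidence_graph X \<B>) \<longleftrightarrow> x \<in> X \<and> b \<in> \<B> \<and> x \<in> b"
  by (auto simp: incidence_graph_def)

text \<open>Since t < v, the set \<open>A\<close> extends to a t-subset of \<open>X\<close>. Applied
  to pairs, this makes any two points collinear and so at distance at most 2.\<close>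

lemma steiner_system_block_through:
  assumes S: "steiner_system t k v X \<B>" and A: "A \<subseteq> X" "card A \<le> t"
  obtains b where "b \<in> \<B>" "A \<subseteq> b"
proof -
  have fin: "finite X" and tv: "t \<le> card X"
    using S by (auto simp: steiner_system_def)
  obtain T where "A \<subseteq> T" "T \<subseteq> X" "card T = t"
    using exists_subset_between[OF A(2) tv A(1) fin] by blast
  moreover from this obtain b where "b \<in> \<B>" "T \<subseteq> b"
    using S unfolding steiner_system_def by blast
  ultimately show thesis using that by blast
qed

lemma steiner_system_block_eq:
  assumes S: "steiner_system t k v X \<B>" and b: "b \<in> \<B>" "c \<in> \<B>" and le: "t \<le> card (b \<inter> c)"
  shows "b = c"
proof -
  obtain T where T: "T \<subseteq> b \<inter> c" "card T = t"
    using obtain_subset_with_card_n[OF le] by metis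
  moreover have "b \<subseteq> X" using S b by (simp add: steiner_system_def)
  ultimately have "\<exists>!b. b \<in> \<B> \<and> T \<subseteq> b"
    using S unfolding steiner_system_def by blast
  then show ?thesis using T b by blast
qed

lemma quadruple_system_block_eq_if_diff_eq:
  assumes S: "steiner_system 3 4 v X \<B>" and b: "b \<in> \<B>" "c \<in> \<B>"
    and T: "card T = 3" and eq: "b - T = c - T"
  shows "b = c"
proof (rule steiner_system_block_eq[OF S b])
  have fT: "finite T" using T by (simp add: card_ge_0_finite)
  have cb: "card b = 4" "card c = 4" using S b by (auto simp: steiner_system_def)
  then have fb: "finite b" "finite c" by (simp_all add: card_ge_0_finite)
  have "card (b - T) + card (b \<inter> T) = 4" "card (c - T) + card (c \<inter> T) = 4"
    using cb fb card_Int_Diff[of b T] card_Int_Diff[of c T] by simp_all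
  moreover have "card (b \<inter> T) + card (c \<inter> T) = card ((b \<union> c) \<inter> T) + card (b \<inter> c \<inter> T)"
    using card_Un_Int[of "b \<inter> T" "c \<inter> T"] fb by (simp add: Int_Un_distrib Int_ac)
  moreover have "card ((b \<union> c) \<inter> T) \<le> 3"
    using card_mono[OF fT, of "(b \<union> c) \<inter> T"] T by simp
  moreover have "card (b \<inter> c) = card (b \<inter> c \<inter> T) + card (b \<inter> c - T)"
    using fb card_Int_Diff[of "b \<inter> c" T] by simp
  moreover have "card (b \<inter> c - T) = card (b - T)" "card (c - T) = card (b - T)"
    using eq by (auto intro: arg_cong[where f = card])
  \<comment> \<open>Let m be the size of \<open>b \<inter> T\<close>, which is also that of
    \<open>c \<inter> T\<close>. If m \<le> 1, the common part outside \<open>T\<close> already has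
    4 - m \<ge> 3 points. Otherwise two m-subsets of a triple share at least 2m - 3 points, which
    gives at least (2m - 3) + (4 - m) = m + 1 \<ge> 3 in all.\<close>
  ultimately show "3 \<le> card (b \<inter> c)" by (cases "card (b \<inter> T) \<le> 1") linarith+
qed

lemma graph_dist_point_block_eq_1_iff:
  assumes "x \<in> X" "b \<in> \<B>"
  shows "graph_dist (incidence_graph X \<B>) (Inl x) (Inr b) = 1 \<longleftrightarrow> x \<in> b"
  using assms by (simp add: graph_dist_eq_1_iff pverts_incidence_graph)

text \<open>Parity in the bipartite graph: two points are at distance 0 or 2, whereas a walk from a
  point to a block has odd length. Thus a single cop on a point tells whether the robber is on a
  point or on a block.\<close>

lemma graph_dist_point_point_neq_point_block:
  assumes S: "steiner_system t k v X \<B>" and "x \<in> X" "y \<in> X"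
  shows "graph_dist (incidence_graph X \<B>) (Inl x) (Inl y)
       \<noteq> graph_dist (incidence_graph X \<B>) (Inl x) (Inr b)"
proof -
  let ?d = "graph_dist (incidence_graph X \<B>)"
  have x: "Inl x \<in> pverts (incidence_graph X \<B>)"
    using assms by (simp add: pverts_incidence_graph)
  have "card {x, y} \<le> t"
    using S by (auto simp: steiner_system_def card_insert_if)
  then obtain c where "c \<in> \<B>" "{x, y} \<subseteq> c"
    using steiner_system_block_through[OF S, of "{x, y}"] assms by auto
  then have "?d (Inl x) (Inl y) \<le> 2"
    using graph_dist_le_2[OF x, of "Inr c" "Inl y"] assms by simp
  moreover have "?d (Inl x) (Inl y) \<noteq> 1"
  proof (cases "x = y")
    case True
    then have "?d (Inl x) (Inl y) = 0" using graph_dist_eq_0_iff[OF x] by simp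
    then show ?thesis by simp
  qed (simp add: graph_dist_eq_1_iff[OF x])
  ultimately have "?d (Inl x) (Inl y) = 0 \<or> ?d (Inl x) (Inl y) = 2"
    by (cases "?d (Inl x) (Inl y)")
      (auto simp: numeral_eq_enat one_enat_def zero_enat_def)
  moreover have "?d (Inl x) (Inr b) \<noteq> 0"
    by (simp add: graph_dist_eq_0_iff[OF x])
  moreover have "?d (Inl x) (Inr b) \<noteq> 2"
  proof
    assume "?d (Inl x) (Inr b) = 2"
    then show False by (rule graph_dist_eq_2D) (case_tac z; simp)
  qed
  ultimately show ?thesis by metis
qed

lemma probe_all_but_triple:
  assumes S: "steiner_system 3 4 v X \<B>" and T: "T \<subseteq> X" "card T = 3"
    and u: "u \<in> pverts (incidence_graph X \<B>)" and w: "w \<in> pverts (incidence_graph X \<B>)"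
    and eq: "\<And>p. p \<in> X - T \<Longrightarrow>
      graph_dist (incidence_graph X \<B>) (Inl p) u = graph_dist (incidence_graph X \<B>) (Inl p) w"
  shows "u = w \<or> u \<in> Inl ` T \<and> w \<in> Inl ` T"
proof -
  have "T \<noteq> X" using S T by (auto simp: steiner_system_def)
  then obtain p where p: "p \<in> X" "p \<notin> T" using T by blast
  have point_point: "u = w \<or> u \<in> Inl ` T \<and> w \<in> Inl ` T"
    if "u = Inl x" "w = Inl y" "x \<in> X" "y \<in> X" for x y
  proof -
    \<comment> \<open>A point outside \<open>T\<close> carries a cop, and only a robber on that very
      point gives this cop distance 0.\<close>
    have "x = y" if "x \<notin> T \<or> y \<notin> T"
      using that eq[of x] eq[of y] \<open>u = Inl x\<close> \<open>w = Inl y\<close> \<open>x \<in> X\<close> \<open>y \<in> X\<close> u w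
        graph_dist_eq_0_iff[OF u] graph_dist_eq_0_iff[OF w]
      by (metis DiffI sum.inject(1))
    then show ?thesis using that by blast
  qed
  have block_block: "u = w" if "u = Inr b" "w = Inr c" "b \<in> \<B>" "c \<in> \<B>" for b c
  proof -
    \<comment> \<open>The cop on \<open>q\<close> reports 1 exactly when \<open>q\<close> lies in
      the robber's block.\<close>
    have "q \<in> b \<longleftrightarrow> q \<in> c" if "q \<in> X - T" for q
      using that eq[of q] \<open>u = Inr b\<close> \<open>w = Inr c\<close>
        graph_dist_point_block_eq_1_iff[of q X _ \<B>] \<open>b \<in> \<B>\<close> \<open>c \<in> \<B>\<close>
      by (metis DiffE)
    moreover have "b \<subseteq> X" "c \<subseteq> X" using S that by (auto simp: steiner_system_def)
    ultimately have "b - T = c - T" by blast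
    then show ?thesis
      using quadruple_system_block_eq_if_diff_eq[OF S] that T by blast
  qed
  \<comment> \<open>What remains is a point against a block; the cop on \<open>p\<close> separates
    these by parity.\<close>
  have "graph_dist (incidence_graph X \<B>) (Inl p) u = graph_dist (incidence_graph X \<B>) (Inl p) w"
    using eq p by simp
  then show ?thesis
    using u w point_point block_block graph_dist_point_point_neq_point_block[OF S \<open>p \<in> X\<close>]
    unfolding pverts_incidence_graph by (elim UnE imageE) (auto dest: sym)
qed

lemma cops_can_win_quadruple_system:
  assumes S: "steiner_system 3 4 v X \<B>"
  shows "cops_can_win (incidence_graph X \<B>) (v - 3)"
proof -
  let ?G = "incidence_graph X \<B>"
  have fin: "finite X" and cX: "card X = v" "4 < v"
    using S by (auto simp: steiner_system_def)
  obtain T where T: "T \<subseteq> X" "card T = 3" "finite T"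
    using obtain_subset_with_card_n[of 3 X] cX by auto
  then obtain a where a: "a \<in> T" by fastforce
  \<comment> \<open>As v > 4, two points are available outside \<open>T\<close>; together with
    \<open>a\<close> they form the second triple \<open>U\<close>, which meets \<open>T\<close> only
    in \<open>a\<close>.\<close>
  have "2 \<le> card (X - T)" using T cX by (simp add: card_Diff_subset)
  then obtain P where P: "P \<subseteq> X - T" "card P = 2" "finite P"
    using obtain_subset_with_card_n by metis
  define U where "U = insert a P"
  have U: "U \<subseteq> X" "card U = 3" "finite U" and TU: "T \<inter> U = {a}"
    using P T a by (auto simp: U_def card_insert_if)
  obtain ps where ps: "set ps = X - T" "distinct ps"
    using finite_distinct_list[of "X - T"] fin by blast
  obtain qs where qs: "set qs = X - U" "distinct qs"
    using finite_distinct_list[of "X - U"] fin by blast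
  \<comment> \<open>The only information used from the history is whether it is empty: the first
    probe omits \<open>T\<close>, every later one omits \<open>U\<close>.\<close>
  define \<sigma> :: "('a + 'a set) cop_strategy"
    where "\<sigma> = (\<lambda>h. map Inl (if h = [] then ps else qs))"
  have "length ps = v - 3" "length qs = v - 3"
    using ps qs T U cX by (metis card_Diff_subset distinct_card)+
  then have "cop_strategy ?G (v - 3) \<sigma>"
    using ps qs by (auto simp: cop_strategy_def \<sigma>_def pverts_incidence_graph)
  moreover have "\<exists>n. located ?G \<sigma> r n" if r: "robber_play ?G r" for r
  proof (cases "r 0 \<in> Inl ` T")
    \<comment> \<open>The definition of a play puts only the start among the vertices; later
      positions follow because arcs end in vertices.\<close>
    have in_verts: "r n \<in> pverts ?G" if "robber_play ?G r" for r n
    proof (induction n)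
      case (Suc n)
      have "r (Suc n) = r n \<or> (r n, r (Suc n)) \<in> parcs ?G"
        using that by (simp add: robber_play_def)
      then show ?case using Suc
        by (auto simp: incidence_graph_def)
    qed (use that in \<open>simp add: robber_play_def\<close>)
    have first: "r' 0 = r 0 \<or> r' 0 \<in> Inl ` T \<and> r 0 \<in> Inl ` T"
      if "robber_play ?G r'" "answers ?G \<sigma> r' (Suc 0) = answers ?G \<sigma> r (Suc 0)" for r'
      using that ps by (intro probe_all_but_triple[OF S T(1,2)] in_verts r) (auto simp: \<sigma>_def)
    {
      case False
      then have "located ?G \<sigma> r 0"
        using first unfolding located_def by blast
      then show ?thesis by blast
    next
      case True
      \<comment> \<open>No arc joins two points, so the robber stood still and his point lies in
        both triples.\<close>
      have stay: "s 1 = Inl a" if "robber_play ?G s" "s 0 \<in> Inl ` T" "s 1 \<in> Inl ` U" for s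
      proof -
        have "s 1 = s 0 \<or> (s 0, s 1) \<in> parcs ?G"
          using that by (simp add: robber_play_def)
        then have "s 1 = s 0" using that by auto
        then show ?thesis using that TU by auto
      qed
      have "located ?G \<sigma> r 1"
        unfolding located_def
      proof (intro allI impI, elim conjE)
        fix r' assume r': "robber_play ?G r'"
          and ans: "answers ?G \<sigma> r' (Suc 1) = answers ?G \<sigma> r (Suc 1)"
        \<comment> \<open>Agreement up to probe 1 includes agreement at probe 0, so the competing
          play also starts in \<open>T\<close>.\<close>
        then have "r' 0 \<in> Inl ` T"
          using first[OF r'] True by auto
        moreover have "r' 1 = r 1 \<or> r' 1 \<in> Inl ` U \<and> r 1 \<in> Inl ` U"
          using ans qs by (intro probe_all_but_triple[OF S U(1,2)] in_verts r r') (auto simp: \<sigma>_def)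
        \<comment> \<open>If the second probe leaves both plays in \<open>U\<close>, then
          \<open>stay\<close> puts each of them at \<open>a\<close>.\<close>
        ultimately show "r' 1 = r 1"
          using stay r r' True by metis
      qed
      then show ?thesis by blast
    }
  qed
  ultimately show ?thesis unfolding cops_can_win_def by blast
qed

theorem theorem4p4:
  fixes X :: "'a set" and \<B> :: "'a set set" and v :: nat
  assumes "v \<ge> 6"
    and "steiner_system 3 4 v X \<B>"
  shows "localization_number (incidence_graph X \<B>) \<le> v - 3"
  unfolding localization_number_def
  by (rule Least_le) (rule cops_can_win_quadruple_system[OF assms(2)])

end
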